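(* Let $\beta,\mu>0$ and let $n_s,n_t\in\mathbb N$ with $n_s\ge n_t$. Set $h_s=\beta/(2n_s)$, $h_t=\mu/n_t$, and define $s_i=h_s i$ for $i=0,\ldots,n_s$ and $t_j=h_t j$ for $j=0,\ldots,n_t$. Let $\boldsymbol R^{\mathrm{db}}\in\mathbb R^{(n_s+1)\times(n_t+1)}$ be the matrix with entries $$R^{\mathrm{db}}_{i,j}=2\exp\left(-\frac{\beta}{2}t_j\right)T_j\left(\cosh(s_ih_t)\right),$$ and set $$q=\left\lfloor\frac{n_s+1}{n_t+1}\right\rfloor.$$ Then the condition number of $\boldsymbol R^{\mathrm{db}}$ satisfies $$2\left(\frac{2n_t}{\beta\mu}\right)^{2n_t}\le\kappa(\boldsymbol R^{\mathrm{db}})\le\sqrt{\frac{(n_s+1)(n_t+1)}{q}}\,\exp(\beta\mu)\left(\frac{4e\,n_s}{\beta\mu q}\right)^{2n_t}.$$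
   Context: $\mathbb N$ denotes the positive integers. $T_j$ is the Chebyshev polynomial of the first kind of degree $j$ (so $T_j(\cosh x)=\cosh(jx)$). For a real rectangular matrix $\boldsymbol R$ with at least as many rows as columns, $\kappa(\boldsymbol R)$ is the spectral-norm condition number $\kappa(\boldsymbol R)=\sqrt{\lambda_{\max}(\boldsymbol R^\top\boldsymbol R)/\lambda_{\min}(\boldsymbol R^\top\boldsymbol R)}$, i.e. the ratio of the largest to the smallest singular value. $e$ is Euler's number. *)

theory Defs
  imports Complex_Main "Jordan_Normal_Form.Char_Poly"
begin

fun chebyshev_T :: "nat \<Rightarrow> real poly" where
  "chebyshev_T 0 = 1"
| "chebyshev_T (Suc 0) = [:0, 1:]"
| "chebyshev_T (Suc (Suc n)) = [:0, 2:] * chebyshev_T (Suc n) - chebyshev_T n"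

lemma chebyshev_T_cosh: "poly (chebyshev_T j) (cosh x) = cosh (real j * x)"
proof (induction j rule: chebyshev_T.induct)
  case (3 n)
  have "cosh (real (Suc (Suc n)) * x) + cosh (real n * x)
      = cosh (real (Suc n) * x + x) + cosh (real (Suc n) * x - x)"
    by (simp add: algebra_simps)
  also have "\<dots> = 2 * cosh x * cosh (real (Suc n) * x)"
    by (simp only: cosh_add cosh_diff) simp
  finally show ?case using 3 by simp
qed simp_all

text \<open>The following are meant for symmetric matrices, whose (real) spectrum is finite and,
  in positive dimension, nonempty.\<close>

definition eigenvalue_max :: "real mat \<Rightarrow> real" where
  "eigenvalue_max A = Max {c. eigenvalue A c}"

definition eigenvalue_min :: "real mat \<Rightarrow> real" where
  "eigenvalue_min A = Min {c. eigenvalue A c}"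

text \<open>For \<open>R\<close> with at least as many rows as columns. If \<open>R\<close> does not have full column rank,
  the condition number is conventionally infinite, whereas division by zero makes this
  value \<open>0\<close>; a positive lower bound on \<open>cond_number R\<close> thus entails full column rank.\<close>

definition cond_number :: "real mat \<Rightarrow> real" where
  "cond_number R = sqrt (eigenvalue_max (R\<^sup>T * R) / eigenvalue_min (R\<^sup>T * R))"

end

theory Submission
  imports Defs
begin

text \<open>With \<open>a = \<beta> \<mu> / (2 n\<^sub>t)\<close>, the vector \<open>R x\<close> lists the values of a Chebyshev expansion with coefficients
  \<open>2 exp (- a j) x\<^sub>j\<close> at \<open>n\<^sub>s + 1\<close> nodes in \<open>[1, cosh a]\<close>. For the upper bound, the rows contain \<open>q\<close>
  disjoint equispaced blocks of \<open>n\<^sub>t + 1\<close> rows; on each block the coefficients are recovered from the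
  values through the Chebyshev expansions of the Lagrange basis, whose coefficient sums are at most
  \<open>\<Prod>i. (1 + z\<^sub>i) / \<bar>z\<^sub>l - z\<^sub>i\<bar>\<close> since multiplication by \<open>z - c\<close> enlarges the sum of absolute values of
  Chebyshev coefficients at most by the factor \<open>1 + \<bar>c\<bar>\<close>. This bounds the smallest singular value from
  below, and all entries are at most \<open>2\<close>. For the lower bound, compare the first column, which is
  constantly \<open>2\<close>, with the image of the coefficient vector of \<open>(z - 1) ^ n\<^sub>t\<close>.\<close>

section \<open>Extremal eigenvalues of Gram matrices\<close>

lemma scalar_prod_self: "v \<bullet> v = (\<Sum>j<K. (v $ j)\<^sup>2)" if "v \<in> carrier_vec K" for v :: "real vec"
  using that by (simp add: scalar_prod_def atLeast0LessThan power2_eq_square)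

lemma abs_quadratic_form_le:
  fixes M :: "real mat"
  assumes M: "M \<in> carrier_mat n n"
  obtains C where "C > 0" "\<And>x. x \<in> carrier_vec n \<Longrightarrow> \<bar>x \<bullet> (M *\<^sub>v x)\<bar> \<le> C * (x \<bullet> x)"
proof
  define C where "C = (\<Sum>i<n. \<Sum>j<n. \<bar>M $$ (i,j)\<bar>)"
  have "C \<ge> 0"
    unfolding C_def by (intro sum_nonneg) auto
  \<comment> \<open>\<open>C\<close> vanishes for the zero matrix, but the constant is inverted
    later, hence the \<open>+ 1\<close>.\<close>
  then show "C + 1 > 0" by simp
  fix x :: "real vec" assume x: "x \<in> carrier_vec n"
  have xx: "x \<bullet> x = (\<Sum>i<n. (x $ i)\<^sup>2)"
    by (rule scalar_prod_self[OF x])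
  have entry: "\<bar>x $ i * x $ j\<bar> \<le> x \<bullet> x" if "i < n" "j < n" for i j
  proof -
    have "(x $ k)\<^sup>2 \<le> x \<bullet> x" if "k < n" for k
      unfolding xx using that by (intro member_le_sum) auto
    from this[OF \<open>i < n\<close>] this[OF \<open>j < n\<close>]
    have "(x $ i)\<^sup>2 + (x $ j)\<^sup>2 \<le> 2 * (x \<bullet> x)" by simp
    moreover have "2 * \<bar>x $ i * x $ j\<bar> \<le> (x $ i)\<^sup>2 + (x $ j)\<^sup>2"
      using sum_squares_bound[of "\<bar>x $ i\<bar>" "\<bar>x $ j\<bar>"] by (simp add: abs_mult)
    ultimately show ?thesis by linarith
  qed
  have "x \<bullet> (M *\<^sub>v x) = (\<Sum>i<n. \<Sum>j<n. M $$ (i,j) * (x $ i * x $ j))"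
    using x M by (auto simp: scalar_prod_def atLeast0LessThan sum_distrib_left mult_ac intro!: sum.cong)
  also have "\<bar>\<dots>\<bar> \<le> (\<Sum>i<n. \<Sum>j<n. \<bar>M $$ (i,j)\<bar> * \<bar>x $ i * x $ j\<bar>)"
    by (rule order.trans[OF sum_abs], intro sum_mono, rule order.trans[OF sum_abs]) (simp add: abs_mult)
  also have "\<dots> \<le> (\<Sum>i<n. \<Sum>j<n. \<bar>M $$ (i,j)\<bar> * (x \<bullet> x))"
    by (intro sum_mono mult_left_mono entry) auto
  also have "\<dots> = C * (x \<bullet> x)"
    by (simp add: C_def sum_distrib_right)
  also have "\<dots> \<le> (C + 1) * (x \<bullet> x)"
    unfolding xx by (intro mult_right_mono sum_nonneg) auto
  finally show "\<bar>x \<bullet> (M *\<^sub>v x)\<bar> \<le> (C + 1) * (x \<bullet> x)" .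
qed

lemma scalar_prod_self_pos:
  fixes v :: "real vec"
  assumes "v \<in> carrier_vec n" "v \<noteq> 0\<^sub>v n"
  shows "v \<bullet> v > 0"
proof -
  obtain i where i: "i < n" "v $ i \<noteq> 0"
    using assms by (metis eq_vecI carrier_vecD dim_vec index_zero_vec)
  have "0 < (v $ i)\<^sup>2" using i by simp
  also have "\<dots> \<le> (\<Sum>i<n. (v $ i)\<^sup>2)" using i by (intro member_le_sum) auto
  also have "\<dots> = v \<bullet> v"
    by (rule scalar_prod_self[OF assms(1), symmetric])
  finally show ?thesis .
qed

lemma scalar_prod_self_nonneg: "v \<bullet> v \<ge> 0" for v :: "real vec"
  by (simp add: scalar_prod_def sum_nonneg)

lemma symmetric_form_swap:
  fixes B :: "real mat"
  assumes "B \<in> carrier_mat n n" "B\<^sup>T = B" "v \<in> carrier_vec n" "w \<in> carrier_vec n"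
  shows "w \<bullet> (B *\<^sub>v v) = v \<bullet> (B *\<^sub>v w)"
proof -
  have "(B *\<^sub>v w) \<bullet> v = w \<bullet> (B *\<^sub>v v)"
    using transpose_vec_mult_scalar[of B n n v w] assms by simp
  moreover have "(B *\<^sub>v w) \<bullet> v = v \<bullet> (B *\<^sub>v w)"
    using assms by (intro comm_scalar_prod[of _ n]) auto
  ultimately show ?thesis by simp
qed

text \<open>With \<open>B w = x\<close>, evaluate the form at \<open>x - t w\<close> for the optimal \<open>t\<close>; this avoids
  compactness of the unit sphere.\<close>
lemma psd_invertible_imp_gap:
  fixes B :: "real mat"
  assumes B: "B \<in> carrier_mat n n" and sym: "B\<^sup>T = B" and inv: "det B \<noteq> 0"
    and psd: "\<And>v. v \<in> carrier_vec n \<Longrightarrow> 0 \<le> v \<bullet> (B *\<^sub>v v)"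
  obtains \<epsilon> where "\<epsilon> > 0" "\<And>v. v \<in> carrier_vec n \<Longrightarrow> \<epsilon> * (v \<bullet> v) \<le> v \<bullet> (B *\<^sub>v v)"
proof -
  obtain W where W: "W \<in> carrier_mat n n" and BW: "B * W = 1\<^sub>m n"
    using det_non_zero_imp_unit[OF B inv, of "()"] unfolding Units_def ring_mat_def by auto
  obtain C where C: "C > 0" "\<And>x. x \<in> carrier_vec n \<Longrightarrow> \<bar>x \<bullet> (W *\<^sub>v x)\<bar> \<le> C * (x \<bullet> x)"
    using abs_quadratic_form_le[OF W] by blast
  have "1 / C * (x \<bullet> x) \<le> x \<bullet> (B *\<^sub>v x)" if x: "x \<in> carrier_vec n" for x
  proof -
    define w where "w = W *\<^sub>v x"
    have w: "w \<in> carrier_vec n" using W x by (simp add: w_def)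
    have Bw: "B *\<^sub>v w = x"
      using assoc_mult_mat_vec[OF B W x] BW x by (simp add: w_def)
    \<comment> \<open>The argument gives \<open>(2 * t - C * t\<^sup>2) * (x \<bullet> x)\<close> as
      a lower bound for the form at \<open>x\<close>; this factor is largest at
      \<open>t = 1 / C\<close>.\<close>
    define t where "t = 1 / C"
    define y where "y = x + (- t) \<cdot>\<^sub>v w"
    have y: "y \<in> carrier_vec n" using x w by (simp add: y_def)
    have By: "B *\<^sub>v y = B *\<^sub>v x + (- t) \<cdot>\<^sub>v x"
      using B x w by (simp add: y_def mult_add_distrib_mat_vec[of _ n n] mult_mat_vec[of _ n n] Bw)
    have Bx: "B *\<^sub>v x \<in> carrier_vec n" using B x by simp
    have "0 \<le> y \<bullet> (B *\<^sub>v y)" by (rule psd[OF y])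
    also have "\<dots> = x \<bullet> (B *\<^sub>v x) - t * (x \<bullet> x) - t * (w \<bullet> (B *\<^sub>v x)) + t\<^sup>2 * (w \<bullet> x)"
      unfolding By using x w Bx
      by (simp add: y_def add_scalar_prod_distrib[of _ n] scalar_prod_add_distrib[of _ n]
          power2_eq_square algebra_simps)
    also have "w \<bullet> (B *\<^sub>v x) = x \<bullet> x"
      using symmetric_form_swap[OF B sym x w] Bw by simp
    also have "w \<bullet> x = x \<bullet> (W *\<^sub>v x)"
      unfolding w_def[symmetric] using x w by (rule comm_scalar_prod[symmetric, of _ n])
    finally have "2 * t * (x \<bullet> x) \<le> x \<bullet> (B *\<^sub>v x) + t\<^sup>2 * (x \<bullet> (W *\<^sub>v x))"
      by simp
    also have "t\<^sup>2 * (x \<bullet> (W *\<^sub>v x)) \<le> t\<^sup>2 * (C * (x \<bullet> x))"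
      using C(2)[OF x] by (intro mult_left_mono) auto
    also have "\<dots> = t * (x \<bullet> x)"
      using C(1) by (simp add: t_def power2_eq_square)
    finally show ?thesis by (simp add: t_def)
  qed
  then show ?thesis using that[of "1 / C"] C(1) by simp
qed

lemma char_matrix_form:
  fixes A :: "real mat"
  assumes A: "A \<in> carrier_mat n n" and v: "v \<in> carrier_vec n"
  shows "v \<bullet> (char_matrix A c *\<^sub>v v) = v \<bullet> (A *\<^sub>v v) - c * (v \<bullet> v)"
proof -
  have "char_matrix A c *\<^sub>v v = A *\<^sub>v v + (- c) \<cdot>\<^sub>v v"
    unfolding char_matrix_def using A v
    by (intro eq_vecI) (auto simp: add_scalar_prod_distrib[of _ n])
  then show ?thesis
    using A v by (simp add: scalar_prod_add_distrib[of _ n])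
qed

text \<open>Take \<open>c\<close> to be the supremum of all lower Rayleigh bounds. The form of
  \<open>A\<close> minus \<open>c\<close> times the identity is then nonnegative; if this matrix
  were invertible, the gap lemma would allow \<open>c\<close> to be raised. So it is
  singular.\<close>

lemma symmetric_eigenvalue_rayleigh:
  fixes A :: "real mat"
  assumes A: "A \<in> carrier_mat n n" and sym: "A\<^sup>T = A" and n: "n > 0"
  obtains c where "eigenvalue A c" "\<And>v. v \<in> carrier_vec n \<Longrightarrow> c * (v \<bullet> v) \<le> v \<bullet> (A *\<^sub>v v)"
proof -
  define S where "S = {c. \<forall>v\<in>carrier_vec n. c * (v \<bullet> v) \<le> v \<bullet> (A *\<^sub>v v)}"
  define c where "c = Sup S"
  obtain C where C: "\<And>x. x \<in> carrier_vec n \<Longrightarrow> \<bar>x \<bullet> (A *\<^sub>v x)\<bar> \<le> C * (x \<bullet> x)"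
    using abs_quadratic_form_le[OF A] by blast
  have "- C \<in> S"
    unfolding S_def using C by (smt (verit) mem_Collect_eq mult_minus_left)
  then have ne: "S \<noteq> {}" by blast
  have u: "unit_vec n 0 \<in> carrier_vec n" "unit_vec n 0 \<bullet> unit_vec n 0 = (1::real)"
    using n by simp_all
  \<comment> \<open>Testing with one unit vector bounds all of \<open>S\<close>; this is where
    \<open>n > 0\<close> enters.\<close>
  have bdd: "bdd_above S"
  proof (rule bdd_aboveI)
    fix d assume "d \<in> S"
    then have "d * (unit_vec n 0 \<bullet> unit_vec n 0) \<le> unit_vec n 0 \<bullet> (A *\<^sub>v unit_vec n 0)"
      using u(1) unfolding S_def by blast
    then show "d \<le> unit_vec n 0 \<bullet> (A *\<^sub>v unit_vec n 0)"
      by (simp only: u(2) mult_1_right)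
  qed
  have cS: "c * (v \<bullet> v) \<le> v \<bullet> (A *\<^sub>v v)" if v: "v \<in> carrier_vec n" for v
  proof (cases "v = 0\<^sub>v n")
    case True
    then show ?thesis using A by (simp add: scalar_prod_def)
  next
    case False
    then have pos: "v \<bullet> v > 0" using scalar_prod_self_pos v by blast
    have "c \<le> v \<bullet> (A *\<^sub>v v) / (v \<bullet> v)"
      unfolding c_def by (rule cSup_least[OF ne]) (use v pos in \<open>auto simp: S_def field_simps\<close>)
    then show ?thesis using pos by (simp add: field_simps)
  qed
  have B: "char_matrix A c \<in> carrier_mat n n" using A by simp
  have symB: "(char_matrix A c)\<^sup>T = char_matrix A c"
  proof (rule eq_matI)
    fix i j assume "i < dim_row (char_matrix A c)" "j < dim_col (char_matrix A c)"
    then have ij: "i < n" "j < n" using B by auto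
    have "A $$ (j, i) = A\<^sup>T $$ (i, j)" using A ij by simp
    then have "A $$ (j, i) = A $$ (i, j)" using sym by simp
    then show "(char_matrix A c)\<^sup>T $$ (i, j) = char_matrix A c $$ (i, j)"
      using A ij by (simp add: char_matrix_def)
  qed (use B in auto)
  have "det (char_matrix A c) = 0"
  proof (rule ccontr)
    assume "det (char_matrix A c) \<noteq> 0"
    then obtain \<epsilon> where e: "\<epsilon> > 0"
      "\<And>v. v \<in> carrier_vec n \<Longrightarrow> \<epsilon> * (v \<bullet> v) \<le> v \<bullet> (char_matrix A c *\<^sub>v v)"
      using psd_invertible_imp_gap[OF B symB] cS char_matrix_form[OF A]
      by (metis diff_ge_0_iff_ge)
    have "c + \<epsilon> \<in> S"
      unfolding S_def using e(2) char_matrix_form[OF A, of _ c] by (force simp: algebra_simps)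
    then have "c + \<epsilon> \<le> c" unfolding c_def using bdd by (rule cSup_upper)
    with e(1) show False by simp
  qed
  then have "eigenvalue A c" using eigenvalue_det[OF A] by simp
  with cS that show ?thesis by blast
qed

lemma finite_eigenvalues:
  assumes "(A :: real mat) \<in> carrier_mat n n"
  shows "finite {c. eigenvalue A c}"
proof -
  have "char_poly A \<noteq> 0" using degree_monic_char_poly[OF assms] by auto
  then show ?thesis
    unfolding eigenvalue_root_char_poly[OF assms] by (rule poly_roots_finite)
qed

text \<open>The eigenvalue supplied by the Rayleigh lemma is at least the minimum, and
  \<open>v \<bullet> v\<close> is nonnegative, so its bound passes to
  \<open>eigenvalue_min A\<close>.\<close>

lemma eigenvalue_min_symmetric:
  fixes A :: "real mat"
  assumes A: "A \<in> carrier_mat n n" and sym: "A\<^sup>T = A" and n: "n > 0"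
  shows "eigenvalue A (eigenvalue_min A)"
    and "v \<in> carrier_vec n \<Longrightarrow> eigenvalue_min A * (v \<bullet> v) \<le> v \<bullet> (A *\<^sub>v v)"
proof -
  obtain c where c: "eigenvalue A c" "\<And>v. v \<in> carrier_vec n \<Longrightarrow> c * (v \<bullet> v) \<le> v \<bullet> (A *\<^sub>v v)"
    using symmetric_eigenvalue_rayleigh[OF assms] by blast
  show "eigenvalue A (eigenvalue_min A)"
    unfolding eigenvalue_min_def using Min_in[OF finite_eigenvalues[OF A]] c(1) by blast
  have "eigenvalue_min A \<le> c"
    unfolding eigenvalue_min_def using finite_eigenvalues[OF A] c(1) by simp
  then show "eigenvalue_min A * (v \<bullet> v) \<le> v \<bullet> (A *\<^sub>v v)" if "v \<in> carrier_vec n"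
    using c(2)[OF that] mult_right_mono[OF _ scalar_prod_self_nonneg[of v]] by fastforce
qed

text \<open>The Rayleigh lemma applied to \<open>- A\<close>, whose eigenvalues are the negated
  eigenvalues of \<open>A\<close>.\<close>

lemma eigenvalue_max_symmetric:
  fixes A :: "real mat"
  assumes A: "A \<in> carrier_mat n n" and sym: "A\<^sup>T = A" and n: "n > 0"
  shows "eigenvalue A (eigenvalue_max A)"
    and "v \<in> carrier_vec n \<Longrightarrow> v \<bullet> (A *\<^sub>v v) \<le> eigenvalue_max A * (v \<bullet> v)"
proof -
  have neg: "- A \<in> carrier_mat n n" "(- A)\<^sup>T = - A"
    using A sym by (auto simp: transpose_uminus)
  have neg_vec: "v \<bullet> (- A *\<^sub>v v) = - (v \<bullet> (A *\<^sub>v v))" if "v \<in> carrier_vec n" for v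
    using A that by simp
  obtain c where c: "eigenvalue (- A) c"
    "\<And>v. v \<in> carrier_vec n \<Longrightarrow> c * (v \<bullet> v) \<le> v \<bullet> (- A *\<^sub>v v)"
    using symmetric_eigenvalue_rayleigh[OF neg n] by blast
  obtain w where w: "w \<in> carrier_vec n" "w \<noteq> 0\<^sub>v n" "- A *\<^sub>v w = c \<cdot>\<^sub>v w"
    using c(1) A unfolding eigenvalue_def eigenvector_def by auto
  have "A *\<^sub>v w = - (- A *\<^sub>v w)"
    using A w(1) by simp
  also have "\<dots> = (- c) \<cdot>\<^sub>v w" unfolding w(3) using w(1) by auto
  finally have ev: "eigenvalue A (- c)"
    using w(1,2) A unfolding eigenvalue_def eigenvector_def by auto
  then show "eigenvalue A (eigenvalue_max A)"
    unfolding eigenvalue_max_def using Max_in[OF finite_eigenvalues[OF A]] by blast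
  have "- c \<le> eigenvalue_max A"
    unfolding eigenvalue_max_def using finite_eigenvalues[OF A] ev by simp
  then show "v \<bullet> (A *\<^sub>v v) \<le> eigenvalue_max A * (v \<bullet> v)" if "v \<in> carrier_vec n"
    using c(2)[OF that] neg_vec[OF that] mult_right_mono[OF _ scalar_prod_self_nonneg[of v]]
    by fastforce
qed

section \<open>Singular values of a matrix given by its entries, in terms of finite sums\<close>

lemma gram_quadratic_form:
  fixes f :: "nat \<Rightarrow> nat \<Rightarrow> real" and N K :: nat
  defines "R \<equiv> mat N K (\<lambda>(i, j). f i j)"
  assumes v: "v \<in> carrier_vec K"
  shows "v \<bullet> ((R\<^sup>T * R) *\<^sub>v v) = (\<Sum>i<N. (\<Sum>j<K. f i j * v $ j)\<^sup>2)"
proof -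
  have R: "R \<in> carrier_mat N K" by (simp add: R_def)
  have Rv: "R *\<^sub>v v \<in> carrier_vec N" using R v by simp
  have "(R\<^sup>T * R) *\<^sub>v v = R\<^sup>T *\<^sub>v (R *\<^sub>v v)"
    using R v by (intro assoc_mult_mat_vec[of _ K N _ K]) auto
  then have "v \<bullet> ((R\<^sup>T * R) *\<^sub>v v) = (R\<^sup>T *\<^sub>v (R *\<^sub>v v)) \<bullet> v"
    using R Rv v by (simp add: comm_scalar_prod[of v K])
  also have "\<dots> = (R *\<^sub>v v) \<bullet> (R *\<^sub>v v)"
    by (rule transpose_vec_mult_scalar[OF R v Rv])
  also have "\<dots> = (\<Sum>i<N. ((R *\<^sub>v v) $ i)\<^sup>2)"
    using R by (simp add: scalar_prod_def atLeast0LessThan power2_eq_square)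
  also have "\<dots> = (\<Sum>i<N. (\<Sum>j<K. f i j * v $ j)\<^sup>2)"
    using v by (intro sum.cong refl) (simp add: R_def scalar_prod_def atLeast0LessThan)
  finally show ?thesis .
qed

context
  fixes f :: "nat \<Rightarrow> nat \<Rightarrow> real" and N K :: nat and R A :: "real mat"
  assumes K: "K > 0"
  defines "R \<equiv> mat N K (\<lambda>(i, j). f i j)" and "A \<equiv> R\<^sup>T * R"
begin

lemma gram_carrier: "A \<in> carrier_mat K K" "A\<^sup>T = A"
  by (auto simp: A_def R_def transpose_mult[of _ K N _ K])

text \<open>An eigenvalue is the Rayleigh quotient of its eigenvector, so a bound on all quotients
  is a bound on the eigenvalues. Vectors become plain functions here, which keeps the later
  estimates free of matrices.\<close>

lemma gram_eigenvector:
  assumes "eigenvalue A c"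
  obtains x where "(\<Sum>j<K. (x j)\<^sup>2) > 0"
    "(\<Sum>i<N. (\<Sum>j<K. f i j * x j)\<^sup>2) = c * (\<Sum>j<K. (x j)\<^sup>2)"
proof -
  obtain v where v: "v \<in> carrier_vec K" "v \<noteq> 0\<^sub>v K" "A *\<^sub>v v = c \<cdot>\<^sub>v v"
    using assms gram_carrier(1) unfolding eigenvalue_def eigenvector_def by auto
  have "(\<Sum>i<N. (\<Sum>j<K. f i j * v $ j)\<^sup>2) = v \<bullet> (A *\<^sub>v v)"
    unfolding A_def R_def by (rule gram_quadratic_form[OF v(1), symmetric])
  also have "\<dots> = c * (v \<bullet> v)" unfolding v(3) using v(1) by simp
  finally show ?thesis
    using that[of "\<lambda>j. v $ j"] scalar_prod_self_pos[OF v(1,2)] scalar_prod_self[OF v(1)] by simp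
qed

lemma eigenvalue_max_gram_le:
  assumes "\<And>x. (\<Sum>i<N. (\<Sum>j<K. f i j * x j)\<^sup>2) \<le> C * (\<Sum>j<K. (x j)\<^sup>2)"
  shows "eigenvalue_max A \<le> C"
proof -
  obtain x where "(\<Sum>j<K. (x j)\<^sup>2) > 0"
    "(\<Sum>i<N. (\<Sum>j<K. f i j * x j)\<^sup>2) = eigenvalue_max A * (\<Sum>j<K. (x j)\<^sup>2)"
    by (rule gram_eigenvector[OF eigenvalue_max_symmetric(1)[OF gram_carrier K]])
  with assms[of x] show ?thesis by simp
qed

lemma eigenvalue_min_gram_ge:
  assumes "\<And>x. C * (\<Sum>j<K. (x j)\<^sup>2) \<le> (\<Sum>i<N. (\<Sum>j<K. f i j * x j)\<^sup>2)"
  shows "C \<le> eigenvalue_min A"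
proof -
  obtain x where "(\<Sum>j<K. (x j)\<^sup>2) > 0"
    "(\<Sum>i<N. (\<Sum>j<K. f i j * x j)\<^sup>2) = eigenvalue_min A * (\<Sum>j<K. (x j)\<^sup>2)"
    by (rule gram_eigenvector[OF eigenvalue_min_symmetric(1)[OF gram_carrier K]])
  with assms[of x] show ?thesis by simp
qed

lemma eigenvalue_max_gram_ge:
  "(\<Sum>i<N. (\<Sum>j<K. f i j * x j)\<^sup>2) \<le> eigenvalue_max A * (\<Sum>j<K. (x j)\<^sup>2)"
  using eigenvalue_max_symmetric(2)[OF gram_carrier K, of "vec K x"]
    gram_quadratic_form[of "vec K x" K N f] scalar_prod_self[of "vec K x" K]
  by (simp add: A_def R_def)

lemma eigenvalue_min_gram_le:
  "eigenvalue_min A * (\<Sum>j<K. (x j)\<^sup>2) \<le> (\<Sum>i<N. (\<Sum>j<K. f i j * x j)\<^sup>2)"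
  using eigenvalue_min_symmetric(2)[OF gram_carrier K, of "vec K x"]
    gram_quadratic_form[of "vec K x" K N f] scalar_prod_self[of "vec K x" K]
  by (simp add: A_def R_def)

lemma cond_number_le:
  assumes a: "0 \<le> a" and b: "0 < b"
    and upper: "\<And>x. (\<Sum>i<N. (\<Sum>j<K. f i j * x j)\<^sup>2) \<le> a\<^sup>2 * (\<Sum>j<K. (x j)\<^sup>2)"
    and lower: "\<And>x. b\<^sup>2 * (\<Sum>j<K. (x j)\<^sup>2) \<le> (\<Sum>i<N. (\<Sum>j<K. f i j * x j)\<^sup>2)"
  shows "cond_number R \<le> a / b"
proof -
  have "eigenvalue_max A / eigenvalue_min A \<le> a\<^sup>2 / b\<^sup>2"
    using eigenvalue_max_gram_le[OF upper] eigenvalue_min_gram_ge[OF lower] b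
    by (intro frac_le) auto
  then have "cond_number R \<le> sqrt ((a / b)\<^sup>2)"
    unfolding cond_number_def A_def[symmetric] by (simp add: power_divide)
  then show ?thesis using a b by simp
qed

text \<open>Without \<open>lower\<close> the smallest eigenvalue may vanish and \<open>cond_number R\<close> be \<open>0\<close>.\<close>
lemma cond_number_ge:
  assumes a: "0 \<le> a" and b: "0 < b" and d: "0 < d"
    and lower: "\<And>x. b\<^sup>2 * (\<Sum>j<K. (x j)\<^sup>2) \<le> (\<Sum>i<N. (\<Sum>j<K. f i j * x j)\<^sup>2)"
    and u: "(\<Sum>j<K. (u j)\<^sup>2) > 0" "a\<^sup>2 * (\<Sum>j<K. (u j)\<^sup>2) \<le> (\<Sum>i<N. (\<Sum>j<K. f i j * u j)\<^sup>2)"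
    and w: "(\<Sum>j<K. (w j)\<^sup>2) > 0" "(\<Sum>i<N. (\<Sum>j<K. f i j * w j)\<^sup>2) \<le> d\<^sup>2 * (\<Sum>j<K. (w j)\<^sup>2)"
  shows "a / d \<le> cond_number R"
proof -
  have max: "a\<^sup>2 \<le> eigenvalue_max A"
    using order.trans[OF u(2) eigenvalue_max_gram_ge] u(1) by simp
  have min: "eigenvalue_min A \<le> d\<^sup>2"
    using order.trans[OF eigenvalue_min_gram_le w(2)] w(1) by simp
  have "0 < b\<^sup>2" using b by simp
  then have pos: "0 < eigenvalue_min A" using eigenvalue_min_gram_ge[OF lower] by linarith
  have "a\<^sup>2 / d\<^sup>2 \<le> eigenvalue_max A / eigenvalue_min A"
    using max min pos order.trans[OF zero_le_power2 max] by (intro frac_le) auto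
  then have "sqrt ((a / d)\<^sup>2) \<le> cond_number R"
    unfolding cond_number_def A_def[symmetric] by (simp add: power_divide)
  then show ?thesis using a d by simp
qed

end

section \<open>Chebyshev expansions\<close>

text \<open>By \<open>2 * cosh x * cosh (k * x) = cosh ((k + 1) * x) + cosh ((k - 1) * x)\<close>,
  multiplication by \<open>cosh x\<close> sends half of each coefficient to either neighbour, which
  does not increase the sum of absolute values; the constant \<open>a\<close> adds
  \<open>\<bar>a\<bar>\<close> times that sum.\<close>

lemma mult_cosh_expansion:
  fixes c :: "nat \<Rightarrow> real"
  obtains c' where
    "\<And>x. (cosh x - a) * (\<Sum>j\<le>n. c j * cosh (real j * x)) = (\<Sum>j\<le>Suc n. c' j * cosh (real j * x))"
    "(\<Sum>j\<le>Suc n. \<bar>c' j\<bar>) \<le> (1 + \<bar>a\<bar>) * (\<Sum>j\<le>n. \<bar>c j\<bar>)"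
    "c' (Suc n) = (if n = 0 then c 0 else c n / 2)"
proof
  \<comment> \<open>\<open>d\<close> pads \<open>c\<close> with zeros; \<open>u\<close> collects
    what moves up by one index and \<open>d (Suc k) / 2\<close> what moves down to \<open>k\<close>.
    Index 0 moves up undivided because \<open>cosh 0 = 1\<close>.\<close>
  define d where "d j = (if j \<le> n then c j else 0)" for j
  define u where "u k = (case k of 0 \<Rightarrow> 0 | Suc k \<Rightarrow> if k = 0 then d 0 else d k / 2)" for k
  define c' where "c' k = u k + d (Suc k) / 2 - a * d k" for k
  \<comment> \<open>The reindexing facts take an arbitrary \<open>g\<close> because they serve both
    the identity and the sum of absolute values.\<close>
  have shift: "(\<Sum>k\<le>Suc n. g (Suc k)) = (\<Sum>k\<le>n. g k)"
    if "g 0 = 0" "\<And>k. k > n \<Longrightarrow> g k = 0" for g :: "nat \<Rightarrow> real"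
    using sum.atMost_Suc_shift[of g "Suc n"] that by simp
  have u_shift: "(\<Sum>k\<le>Suc n. g k (u k)) = (\<Sum>k\<le>n. g (Suc k) (u (Suc k)))"
    if "g 0 0 = 0" for g :: "nat \<Rightarrow> real \<Rightarrow> real"
    unfolding sum.atMost_Suc_shift using that by (simp add: u_def)
  have d_top: "(\<Sum>k\<le>Suc n. g k (d k)) = (\<Sum>k\<le>n. g k (d k))"
    if "g (Suc n) 0 = 0" for g :: "nat \<Rightarrow> real \<Rightarrow> real"
    using that by (simp add: d_def)
  have d_c: "(\<Sum>k\<le>n. g k (d k)) = (\<Sum>k\<le>n. g k (c k))" for g :: "nat \<Rightarrow> real \<Rightarrow> real"
    by (rule sum.cong) (auto simp: d_def)
  show "(cosh x - a) * (\<Sum>j\<le>n. c j * cosh (real j * x)) = (\<Sum>j\<le>Suc n. c' j * cosh (real j * x))" for x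
  proof -
    have step: "cosh x * (d k * cosh (real k * x)) = u (Suc k) * cosh (real (Suc k) * x)
        + (if k = 0 then 0 else d k / 2 * cosh (real (k - 1) * x))" for k
    proof (cases k)
      case (Suc i)
      have "cosh (real (Suc (Suc i)) * x) + cosh (real i * x)
          = cosh (real (Suc i) * x + x) + cosh (real (Suc i) * x - x)"
        by (simp add: algebra_simps)
      also have "\<dots> = 2 * (cosh x * cosh (real (Suc i) * x))"
        by (simp only: cosh_add cosh_diff) simp
      finally have "cosh x * cosh (real (Suc i) * x)
          = (cosh (real (Suc (Suc i)) * x) + cosh (real i * x)) / 2" by simp
      then have "cosh x * (d k * cosh (real k * x))
          = d k * ((cosh (real (Suc (Suc i)) * x) + cosh (real i * x)) / 2)"
        unfolding Suc by (metis mult.left_commute)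
      then show ?thesis unfolding Suc by (simp add: u_def field_simps)
    qed (simp add: u_def)
    have "(\<Sum>j\<le>Suc n. c' j * cosh (real j * x)) = (\<Sum>k\<le>Suc n. u k * cosh (real k * x))
        + (\<Sum>k\<le>Suc n. d (Suc k) / 2 * cosh (real k * x)) - a * (\<Sum>k\<le>Suc n. d k * cosh (real k * x))"
      unfolding c'_def sum_distrib_left sum.distrib[symmetric] sum_subtractf[symmetric]
      by (rule sum.cong) (auto simp: algebra_simps)
    also have "(\<Sum>k\<le>Suc n. u k * cosh (real k * x)) = (\<Sum>k\<le>n. u (Suc k) * cosh (real (Suc k) * x))"
      by (rule u_shift) simp
    also have "(\<Sum>k\<le>Suc n. d (Suc k) / 2 * cosh (real k * x))
        = (\<Sum>k\<le>n. if k = 0 then 0 else d k / 2 * cosh (real (k - 1) * x))"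
      using shift[of "\<lambda>k. if k = 0 then 0 else d k / 2 * cosh (real (k - 1) * x)"]
      by (simp add: d_def)
    also have "(\<Sum>k\<le>Suc n. d k * cosh (real k * x)) = (\<Sum>k\<le>n. d k * cosh (real k * x))"
      by (rule d_top) simp
    finally have "(\<Sum>j\<le>Suc n. c' j * cosh (real j * x))
        = cosh x * (\<Sum>k\<le>n. d k * cosh (real k * x)) - a * (\<Sum>k\<le>n. d k * cosh (real k * x))"
      unfolding sum_distrib_left[of "cosh x"] step sum.distrib by simp
    then show ?thesis
      using d_c[of "\<lambda>k y. y * cosh (real k * x)"] by (simp add: left_diff_distrib)
  qed
  have "(\<Sum>j\<le>Suc n. \<bar>c' j\<bar>) \<le> (\<Sum>k\<le>Suc n. \<bar>u k\<bar> + \<bar>d (Suc k)\<bar> / 2 + \<bar>a\<bar> * \<bar>d k\<bar>)"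
    unfolding c'_def by (intro sum_mono) (simp add: abs_mult[symmetric])
  also have "\<dots> = (\<Sum>k\<le>Suc n. \<bar>u k\<bar>) + (\<Sum>k\<le>Suc n. \<bar>d (Suc k)\<bar> / 2) + \<bar>a\<bar> * (\<Sum>k\<le>Suc n. \<bar>d k\<bar>)"
    unfolding sum.distrib sum_distrib_left by simp
  also have "(\<Sum>k\<le>Suc n. \<bar>u k\<bar>) = (\<Sum>k\<le>n. \<bar>u (Suc k)\<bar>)"
    by (rule u_shift) simp
  also have "(\<Sum>k\<le>Suc n. \<bar>d (Suc k)\<bar> / 2) = (\<Sum>k\<le>n. if k = 0 then 0 else \<bar>d k\<bar> / 2)"
    using shift[of "\<lambda>k. if k = 0 then 0 else \<bar>d k\<bar> / 2"] by (simp add: d_def)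
  also have "(\<Sum>k\<le>Suc n. \<bar>d k\<bar>) = (\<Sum>k\<le>n. \<bar>d k\<bar>)"
    by (rule d_top) simp
  \<comment> \<open>The amounts leaving index \<open>k\<close> upwards and downwards add up to
    exactly \<open>\<bar>d k\<bar>\<close>.\<close>
  also have "(\<Sum>k\<le>n. \<bar>u (Suc k)\<bar>) + (\<Sum>k\<le>n. if k = 0 then 0 else \<bar>d k\<bar> / 2) = (\<Sum>k\<le>n. \<bar>d k\<bar>)"
    unfolding sum.distrib[symmetric] by (rule sum.cong) (auto simp: u_def)
  finally show "(\<Sum>j\<le>Suc n. \<bar>c' j\<bar>) \<le> (1 + \<bar>a\<bar>) * (\<Sum>j\<le>n. \<bar>c j\<bar>)"
    using d_c[of "\<lambda>k y. \<bar>y\<bar>"] by (simp add: algebra_simps)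
  show "c' (Suc n) = (if n = 0 then c 0 else c n / 2)"
    by (simp add: c'_def u_def d_def)
qed

text \<open>Iterates the previous lemma. The coefficient bound serves the Lagrange basis, the
  leading coefficient serves the power of \<open>cosh x - 1\<close>: the first factor leaves it at 1
  and every further one halves it.\<close>

lemma prod_cosh_expansion:
  fixes a :: "'a \<Rightarrow> real"
  assumes "finite A"
  obtains c where
    "\<And>x. (\<Prod>i\<in>A. cosh x - a i) = (\<Sum>j\<le>card A. c j * cosh (real j * x))"
    "(\<Sum>j\<le>card A. \<bar>c j\<bar>) \<le> (\<Prod>i\<in>A. 1 + \<bar>a i\<bar>)"
    "A \<noteq> {} \<Longrightarrow> c (card A) = 2 / 2 ^ card A"
proof -
  \<comment> \<open>The induction has to include the empty product, whose leading coefficient is 1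
    and not \<open>2 / 2 ^ 0\<close>.\<close>
  have "\<exists>c. (\<forall>x. (\<Prod>i\<in>A. cosh x - a i) = (\<Sum>j\<le>card A. c j * cosh (real j * x)))
    \<and> (\<Sum>j\<le>card A. \<bar>c j\<bar>) \<le> (\<Prod>i\<in>A. 1 + \<bar>a i\<bar>)
    \<and> c (card A) = (if A = {} then 1 else 2 / 2 ^ card A)"
    using assms
  proof (induction rule: finite_induct)
    case empty
    show ?case by (rule exI[of _ "\<lambda>_. 1"]) simp
  next
    case (insert k A)
    then obtain c where c: "\<And>x. (\<Prod>i\<in>A. cosh x - a i) = (\<Sum>j\<le>card A. c j * cosh (real j * x))"
      "(\<Sum>j\<le>card A. \<bar>c j\<bar>) \<le> (\<Prod>i\<in>A. 1 + \<bar>a i\<bar>)"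
      "c (card A) = (if A = {} then 1 else 2 / 2 ^ card A)" by blast
    obtain c' where c': "\<And>x. (cosh x - a k) * (\<Sum>j\<le>card A. c j * cosh (real j * x))
          = (\<Sum>j\<le>Suc (card A). c' j * cosh (real j * x))"
        "(\<Sum>j\<le>Suc (card A). \<bar>c' j\<bar>) \<le> (1 + \<bar>a k\<bar>) * (\<Sum>j\<le>card A. \<bar>c j\<bar>)"
        "c' (Suc (card A)) = (if card A = 0 then c 0 else c (card A) / 2)"
      by (rule mult_cosh_expansion[where a = "a k" and n = "card A" and c = c]) blast
    have "(1 + \<bar>a k\<bar>) * (\<Sum>j\<le>card A. \<bar>c j\<bar>) \<le> (1 + \<bar>a k\<bar>) * (\<Prod>i\<in>A. 1 + \<bar>a i\<bar>)"
      using c(2) by (intro mult_left_mono) auto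
    with c' c insert.hyps show ?case
      by (intro exI[of _ c']) (auto simp del: sum.atMost_Suc simp: field_simps)
  qed
  then show ?thesis using that by auto
qed

text \<open>Column \<open>l\<close> of the inverse of the sampling matrix holds the Chebyshev
  coefficients of the Lagrange basis polynomial at node \<open>l\<close>, so \<open>M\<close> bounds
  the absolute column sums of that inverse.\<close>

lemma cosh_sample_bound:
  fixes c x :: "nat \<Rightarrow> real"
  assumes distinct: "\<And>i l. i \<le> n \<Longrightarrow> l \<le> n \<Longrightarrow> i \<noteq> l \<Longrightarrow> cosh (x i) \<noteq> cosh (x l)"
    and M: "\<And>l. l \<le> n \<Longrightarrow> (\<Prod>i\<in>{..n} - {l}. 1 + cosh (x i))
        \<le> M * (\<Prod>i\<in>{..n} - {l}. \<bar>cosh (x l) - cosh (x i)\<bar>)"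
  shows "(\<Sum>j\<le>n. \<bar>c j\<bar>) \<le> M * (\<Sum>l\<le>n. \<bar>\<Sum>j\<le>n. c j * cosh (real j * x l)\<bar>)"
proof -
  define D where "D l = (\<Prod>i\<in>{..n} - {l}. cosh (x l) - cosh (x i))" for l
  have D_nz: "D l \<noteq> 0" if "l \<le> n" for l
    unfolding D_def using distinct that by fastforce
  have "\<forall>l\<in>{..n}. \<exists>C. (\<forall>y. (\<Prod>i\<in>{..n} - {l}. cosh y - cosh (x i)) = (\<Sum>j\<le>n. C j * cosh (real j * y)))
      \<and> (\<Sum>j\<le>n. \<bar>C j\<bar>) \<le> (\<Prod>i\<in>{..n} - {l}. 1 + cosh (x i))"
  proof
    fix l assume "l \<in> {..n}"
    then have card: "card ({..n} - {l}) = n" by simp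
    show "\<exists>C. (\<forall>y. (\<Prod>i\<in>{..n} - {l}. cosh y - cosh (x i)) = (\<Sum>j\<le>n. C j * cosh (real j * y)))
      \<and> (\<Sum>j\<le>n. \<bar>C j\<bar>) \<le> (\<Prod>i\<in>{..n} - {l}. 1 + cosh (x i))"
      by (rule prod_cosh_expansion[of "{..n} - {l}" "\<lambda>i. cosh (x i)", unfolded card]) auto
  qed
  then obtain C where
    "\<forall>l\<in>{..n}. (\<forall>y. (\<Prod>i\<in>{..n} - {l}. cosh y - cosh (x i)) = (\<Sum>j\<le>n. C l j * cosh (real j * y)))
      \<and> (\<Sum>j\<le>n. \<bar>C l j\<bar>) \<le> (\<Prod>i\<in>{..n} - {l}. 1 + cosh (x i))"
    by (rule bchoice[THEN exE])
  then have
    C: "\<And>l y. l \<le> n \<Longrightarrow> (\<Prod>i\<in>{..n} - {l}. cosh y - cosh (x i)) = (\<Sum>j\<le>n. C l j * cosh (real j * y))"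
      "\<And>l. l \<le> n \<Longrightarrow> (\<Sum>j\<le>n. \<bar>C l j\<bar>) \<le> (\<Prod>i\<in>{..n} - {l}. 1 + cosh (x i))"
    by blast+
  define V where "V = mat (Suc n) (Suc n) (\<lambda>(l, j). cosh (real j * x l))"
  define W where "W = mat (Suc n) (Suc n) (\<lambda>(j, l). C l j / D l)"
  have V: "V \<in> carrier_mat (Suc n) (Suc n)" and W: "W \<in> carrier_mat (Suc n) (Suc n)"
    by (simp_all add: V_def W_def)
  \<comment> \<open>This order of the product is just the evaluation of the Lagrange basis at the
    nodes. Recovering \<open>c\<close> from its samples needs the other order, which follows since
    the matrices are square.\<close>
  have "V * W = 1\<^sub>m (Suc n)"
  proof (rule eq_matI)
    fix i l assume "i < dim_row (1\<^sub>m (Suc n))" "l < dim_col (1\<^sub>m (Suc n))"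
    then have il: "i \<le> n" "l \<le> n" by simp_all
    have "(V * W) $$ (i, l) = (\<Sum>j\<le>n. C l j * cosh (real j * x i)) / D l"
      using il by (simp add: V_def W_def scalar_prod_def atLeast0LessThan lessThan_Suc_atMost
          sum_divide_distrib mult.commute)
    also have "\<dots> = (\<Prod>k\<in>{..n} - {l}. cosh (x i) - cosh (x k)) / D l"
      using C(1)[OF il(2)] by simp
    also have "\<dots> = 1\<^sub>m (Suc n) $$ (i, l)"
    proof (cases "i = l")
      case True
      then show ?thesis using D_nz il by (simp add: D_def)
    next
      case False
      then have "(\<Prod>k\<in>{..n} - {l}. cosh (x i) - cosh (x k)) = 0"
        using il by (intro prod_zero) auto
      then show ?thesis using False il by simp
    qed
    finally show "(V * W) $$ (i, l) = 1\<^sub>m (Suc n) $$ (i, l)" .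
  qed (use V W in auto)
  then have WV: "W * V = 1\<^sub>m (Suc n)"
    using mat_mult_left_right_inverse[OF V W] by simp
  define v where "v l = (\<Sum>j\<le>n. c j * cosh (real j * x l))" for l
  have c_eq: "c j = (\<Sum>l\<le>n. C l j / D l * v l)" if j: "j \<le> n" for j
  proof -
    have entry: "(\<Sum>l\<le>n. C l j / D l * cosh (real k * x l)) = (if j = k then 1 else 0)"
      if "k \<le> n" for k
    proof -
      have "(W * V) $$ (j, k) = (\<Sum>l\<le>n. C l j / D l * cosh (real k * x l))"
        using that j by (simp add: V_def W_def scalar_prod_def atLeast0LessThan lessThan_Suc_atMost)
      then show ?thesis unfolding WV using that j by simp
    qed
    have "(\<Sum>l\<le>n. C l j / D l * v l)
        = (\<Sum>l\<le>n. \<Sum>k\<le>n. c k * (C l j / D l * cosh (real k * x l)))"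
      unfolding v_def sum_distrib_left by (simp add: mult_ac)
    also have "\<dots> = (\<Sum>k\<le>n. c k * (\<Sum>l\<le>n. C l j / D l * cosh (real k * x l)))"
      unfolding sum_distrib_left by (rule sum.swap)
    also have "\<dots> = (\<Sum>k\<le>n. c k * (if j = k then 1 else 0))"
      by (rule sum.cong) (simp_all only: entry atMost_iff)
    also have "\<dots> = c j" using j by (simp add: if_distrib cong: if_cong)
    finally show ?thesis by simp
  qed
  have "(\<Sum>j\<le>n. \<bar>c j\<bar>) \<le> (\<Sum>j\<le>n. \<Sum>l\<le>n. \<bar>C l j\<bar> / \<bar>D l\<bar> * \<bar>v l\<bar>)"
  proof (rule sum_mono)
    fix j assume "j \<in> {..n}"
    then have "c j = (\<Sum>l\<le>n. C l j / D l * v l)" using c_eq by simp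
    also have "\<bar>\<dots>\<bar> \<le> (\<Sum>l\<le>n. \<bar>C l j\<bar> / \<bar>D l\<bar> * \<bar>v l\<bar>)"
      by (rule order.trans[OF sum_abs]) (simp add: abs_mult)
    finally show "\<bar>c j\<bar> \<le> (\<Sum>l\<le>n. \<bar>C l j\<bar> / \<bar>D l\<bar> * \<bar>v l\<bar>)" .
  qed
  also have "\<dots> = (\<Sum>l\<le>n. (\<Sum>j\<le>n. \<bar>C l j\<bar>) / \<bar>D l\<bar> * \<bar>v l\<bar>)"
    unfolding sum_divide_distrib sum_distrib_right by (rule sum.swap)
  also have "\<dots> \<le> (\<Sum>l\<le>n. M * \<bar>v l\<bar>)"
  proof (rule sum_mono, rule mult_right_mono)
    fix l assume "l \<in> {..n}"
    then have l: "l \<le> n" by simp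
    have "(\<Sum>j\<le>n. \<bar>C l j\<bar>) \<le> M * \<bar>D l\<bar>"
      using C(2)[OF l] M[OF l] by (simp add: D_def abs_prod)
    then show "(\<Sum>j\<le>n. \<bar>C l j\<bar>) / \<bar>D l\<bar> \<le> M"
      using D_nz[OF l] by (simp add: field_simps)
  qed simp
  finally show ?thesis by (simp add: v_def sum_distrib_left)
qed

section \<open>Elementary inequalities\<close>

lemma sum_squared_le: "(\<Sum>i\<in>A. f i)\<^sup>2 \<le> real (card A) * (\<Sum>i\<in>A. (f i)\<^sup>2)" for f :: "'a \<Rightarrow> real"
proof -
  have "2 * (\<Sum>i\<in>A. f i)\<^sup>2 = (\<Sum>i\<in>A. \<Sum>j\<in>A. 2 * f i * f j)"
    by (simp add: power2_eq_square sum_product sum_distrib_left mult_ac)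
  also have "\<dots> \<le> (\<Sum>i\<in>A. \<Sum>j\<in>A. (f i)\<^sup>2 + (f j)\<^sup>2)"
    by (intro sum_mono sum_squares_bound)
  also have "\<dots> = 2 * (real (card A) * (\<Sum>i\<in>A. (f i)\<^sup>2))"
    by (simp add: sum.distrib sum_distrib_left)
  finally show ?thesis by simp
qed

text \<open>From \<open>y \<le> sinh y\<close> at \<open>y = ln (1 + 1 / x)\<close>. The right side
  equals \<open>1 / x + 1 / (x + 1)\<close>, which is sharper than what
  \<open>ln (1 + z) \<le> z\<close> gives; the next induction needs the difference.\<close>

lemma two_mult_ln_le: "2 * ln (1 + 1 / x) \<le> (2 * x + 1) / (x * (x + 1))" if "x > 0" for x :: real
proof -
  have "ln (1 + 1 / x) \<le> (exp (ln (1 + 1 / x)) - inverse (exp (ln (1 + 1 / x)))) / 2"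
    using that by (intro real_le_x_sinh) simp
  also have "\<dots> = ((1 + 1 / x) - inverse (1 + 1 / x)) / 2"
    using that by (subst exp_ln) (auto simp: add_pos_pos)
  also have "2 * \<dots> = (2 * x + 1) / (x * (x + 1))"
    using that by (simp add: divide_simps) (simp add: algebra_simps)
  finally show ?thesis by simp
qed

text \<open>A Stirling-type bound by induction. The factor \<open>2 * (n + 1)\<close> is there to
  absorb the 2 of the sampling constant and the \<open>n + 1\<close> lost in comparing
  norms.\<close>

lemma fact_square_lower:
  assumes "n \<ge> 1"
  shows "2 * (real n + 1) * real n ^ (2 * n) \<le> (fact n)\<^sup>2 * exp (2 * real n)"
  using assms
proof (induction n rule: dec_induct)
  case base
  have "(2::real)\<^sup>2 \<le> (exp 1)\<^sup>2" using exp_ge_add_one_self[of 1] by (intro power_mono) auto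
  then show ?case using exp_double[of "1::real"] by simp
next
  case (step n)
  then have n: "real n > 0" by simp
  have "(1 + 1 / real n) ^ (2 * n) = exp (real (2 * n) * ln (1 + 1 / real n))"
    using n by (simp add: exp_of_nat_mult add_pos_pos del: of_nat_mult)
  also have "\<dots> = exp (real n * (2 * ln (1 + 1 / real n)))" by (simp add: mult_ac)
  also have "\<dots> \<le> exp (real n * ((2 * real n + 1) / (real n * (real n + 1))))"
    unfolding exp_le_cancel_iff using n by (intro mult_left_mono two_mult_ln_le) simp_all
  also have "real n * ((2 * real n + 1) / (real n * (real n + 1))) = 2 - 1 / (real n + 1)"
    using n by (simp add: divide_simps)
  finally have growth: "(1 + 1 / real n) ^ (2 * n) \<le> exp (2 - 1 / (real n + 1))" .
  \<comment> \<open>The saving of \<open>1 / (n + 1)\<close> in the exponent pays for the growth of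
    the factor \<open>n + 1\<close>.\<close>
  have "(1 + 1 / (real n + 1)) * (1 + 1 / real n) ^ (2 * n)
      \<le> exp (1 / (real n + 1)) * exp (2 - 1 / (real n + 1))"
    using growth n exp_ge_add_one_self[of "1 / (real n + 1)"] by (intro mult_mono) auto
  also have "\<dots> = exp 2" by (simp add: exp_add[symmetric])
  finally have ratio: "(1 + 1 / (real n + 1)) * (1 + 1 / real n) ^ (2 * n) \<le> exp 2" .
  have "2 * (real (Suc n) + 1) * real (Suc n) ^ (2 * Suc n)
      = (real n + 1)\<^sup>2 * (2 * (real n + 1) * real n ^ (2 * n))
        * ((1 + 1 / (real n + 1)) * (1 + 1 / real n) ^ (2 * n))"
  proof -
    have "real (Suc n) ^ (2 * n) = real n ^ (2 * n) * (1 + 1 / real n) ^ (2 * n)"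
      using n by (simp add: power_mult_distrib[symmetric] field_simps)
    moreover have "real (Suc n) + 1 = (real n + 1) * (1 + 1 / (real n + 1))"
      using n by (simp add: field_simps)
    moreover have "real (Suc n) ^ (2 * Suc n) = (real n + 1)\<^sup>2 * real (Suc n) ^ (2 * n)"
      by (simp add: power2_eq_square mult_ac add_ac)
    ultimately show ?thesis by (simp only: mult_ac)
  qed
  also have "\<dots> \<le> (real n + 1)\<^sup>2 * ((fact n)\<^sup>2 * exp (2 * real n)) * exp 2"
    by (rule mult_mono[OF mult_left_mono[OF step.IH] ratio]) simp_all
  also have "\<dots> = (fact (Suc n))\<^sup>2 * exp (2 * real (Suc n))"
  proof -
    have "exp (2 * real (Suc n)) = exp (2 * real n) * exp 2"
      by (simp add: exp_add[symmetric])
    moreover have "(fact (Suc n) :: real)\<^sup>2 = (real n + 1)\<^sup>2 * (fact n)\<^sup>2"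
      unfolding power_mult_distrib[symmetric] by (simp add: add.commute)
    ultimately show ?thesis by (simp only: mult_ac)
  qed
  finally show ?case .
qed

text \<open>Equivalent to the central binomial coefficient of \<open>2 * n\<close> being the
  largest.\<close>

lemma fact_square_le: "(fact n)\<^sup>2 \<le> (fact (n - l) * fact (n + l) :: real)" if "l \<le> n"
proof -
  have "real ((2 * n) choose (n + l)) \<le> real ((2 * n) choose n)"
    using binomial_maximum'[of n "n + l"] by (simp only: of_nat_le_iff)
  then have "fact (2 * n) / (fact (n + l) * fact (n - l)) \<le> (fact (2 * n) / (fact n * fact n) :: real)"
    using that by (simp add: binomial_fact)
  then have "fact (2 * n) * (fact n * fact n) \<le> (fact (2 * n) * (fact (n + l) * fact (n - l)) :: real)"
    by (simp add: divide_simps mult_ac)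
  then show ?thesis by (simp add: power2_eq_square mult_ac)
qed

text \<open>Splitting each factor into difference times sum gives
  \<open>fact (n - l) * fact (n + l) / 2\<close> for \<open>l > 0\<close> and twice that for
  \<open>l = 0\<close>. The previous lemma then removes the dependence on \<open>l\<close>.\<close>

lemma prod_square_diff_lower:
  assumes "l \<le> n"
  shows "(fact n)\<^sup>2 / 2 \<le> (\<Prod>i\<in>{..n} - {l}. \<bar>(real l)\<^sup>2 - (real i)\<^sup>2\<bar>)"
proof -
  have "(fact (n - l) * fact (n + l) :: real) \<le> 2 * (\<Prod>i\<in>{..n} - {l}. \<bar>(real l)\<^sup>2 - (real i)\<^sup>2\<bar>)"
    using assms
  \<comment> \<open>The induction starts at \<open>n = l\<close>, where all remaining indices lie
    below \<open>l\<close>; each later index contributes exactly the growth of the two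
    factorials.\<close>
  proof (induction n rule: dec_induct)
    case base
    show ?case
    proof (cases l)
      case (Suc m)
      have rising: "(\<Prod>i<k. real l + real i) * fact m = fact (m + k)" for k
      proof (induction k)
        case (Suc k)
        have "(\<Prod>i<Suc k. real l + real i) * fact m = (real l + real k) * ((\<Prod>i<k. real l + real i) * fact m)"
          by (simp add: mult_ac)
        also have "\<dots> = fact (m + Suc k)"
          unfolding Suc.IH using \<open>l = Suc m\<close> by (simp add: add_ac)
        finally show ?case .
      qed simp
      have "(\<Prod>i\<in>{..l} - {l}. \<bar>(real l)\<^sup>2 - (real i)\<^sup>2\<bar>) = (\<Prod>i<l. (real l - real i) * (real l + real i))"
        by (rule prod.cong) (auto simp: power2_eq_square algebra_simps abs_if mult_mono not_less)
      also have "\<dots> = (\<Prod>i<l. real l - real i) * (\<Prod>i<l. real l + real i)"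
        by (rule prod.distrib)
      also have "(\<Prod>i<l. real l - real i) = fact l"
        by (simp add: fact_prod_rev[where 'a = real] atLeast0LessThan of_nat_diff)
      also have "2 * (fact l * (\<Prod>i<l. real l + real i)) = 2 * real l * fact (m + l)"
      proof -
        have "fact l = real l * fact m" by (simp add: Suc)
        then have "2 * (fact l * (\<Prod>i<l. real l + real i))
            = 2 * real l * ((\<Prod>i<l. real l + real i) * fact m)" by (simp only: mult_ac)
        then show ?thesis unfolding rising .
      qed
      also have "\<dots> = fact (l + l)" by (simp add: Suc)
      finally show ?thesis by simp
    qed simp
  next
    case (step n)
    have "{..Suc n} - {l} = insert (Suc n) ({..n} - {l})" using step.hyps by auto
    then have "(\<Prod>i\<in>{..Suc n} - {l}. \<bar>(real l)\<^sup>2 - (real i)\<^sup>2\<bar>)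
        = \<bar>(real l)\<^sup>2 - (real (Suc n))\<^sup>2\<bar> * (\<Prod>i\<in>{..n} - {l}. \<bar>(real l)\<^sup>2 - (real i)\<^sup>2\<bar>)"
      by simp
    moreover have "\<bar>(real l)\<^sup>2 - (real (Suc n))\<^sup>2\<bar> = real (Suc n - l) * real (Suc n + l)"
    proof -
      have "(real l)\<^sup>2 - (real (Suc n))\<^sup>2 = - (real (Suc n - l) * real (Suc n + l))"
        using step.hyps by (simp add: power2_eq_square algebra_simps of_nat_diff)
      then show ?thesis by (simp only: abs_minus_cancel) simp
    qed
    moreover have "fact (Suc n - l) * fact (Suc n + l)
        = real (Suc n - l) * real (Suc n + l) * (fact (n - l) * fact (n + l))"
      using step.hyps by (simp add: Suc_diff_le algebra_simps)
    ultimately show ?case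
      using mult_left_mono[OF step.IH, of "real (Suc n - l) * real (Suc n + l)"]
      by (simp only: mult_ac)
  qed
  with fact_square_le[OF assms] show ?thesis by simp
qed

text \<open>The difference is \<open>2 * sinh ((x + y) / 2) * sinh ((x - y) / 2)\<close>, and
  \<open>\<bar>sinh u\<bar> \<ge> \<bar>u\<bar>\<close>. Gaps between nodes thus reduce to
  differences of squares.\<close>

lemma cosh_diff_lower:
  fixes x y :: real
  assumes "0 \<le> x" "0 \<le> y"
  shows "\<bar>x\<^sup>2 - y\<^sup>2\<bar> / 2 \<le> \<bar>cosh x - cosh y\<bar>"
proof -
  define p q where "p = (x + y) / 2" and "q = (x - y) / 2"
  have sinh: "\<bar>u\<bar> \<le> \<bar>sinh u\<bar>" for u :: real
    using real_le_abs_sinh[of u] by (simp add: sinh_field_def exp_minus)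
  have xy: "x = p + q" "y = p - q" by (simp_all add: p_def q_def field_simps)
  have "cosh x - cosh y = 2 * (sinh p * sinh q)"
    unfolding xy by (simp add: cosh_add cosh_diff)
  then have "\<bar>cosh x - cosh y\<bar> = 2 * (\<bar>sinh p\<bar> * \<bar>sinh q\<bar>)" by (simp add: abs_mult)
  also have "\<dots> \<ge> 2 * (\<bar>p\<bar> * \<bar>q\<bar>)" by (intro mult_left_mono mult_mono sinh) auto
  also have "2 * (\<bar>p\<bar> * \<bar>q\<bar>) = \<bar>x\<^sup>2 - y\<^sup>2\<bar> / 2"
    unfolding xy by (simp add: abs_mult[symmetric] power2_eq_square algebra_simps)
  finally show ?thesis .
qed

lemma cosh_le_exp: "cosh x \<le> exp x" if "x \<ge> 0" for x :: real
  using that by (simp add: cosh_field_def)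

section \<open>Bounds on the singular values\<close>

text \<open>Numerators are bounded through \<open>1 + cosh y \<le> 2 * exp X\<close>, denominators
  through gaps of at least \<open>\<delta>\<^sup>2 / 2\<close> times a difference of squared
  indices.\<close>

lemma equispaced_cosh_sample_bound:
  fixes c :: "nat \<Rightarrow> real"
  assumes \<tau>: "0 \<le> \<tau>" and \<delta>: "0 < \<delta>" and X: "\<tau> + \<delta> * real n \<le> X"
  shows "(\<Sum>j\<le>n. \<bar>c j\<bar>) \<le> 2 * exp (real n * X) * (2 / \<delta>) ^ (2 * n) / (fact n)\<^sup>2
    * (\<Sum>l\<le>n. \<bar>\<Sum>j\<le>n. c j * cosh (real j * (\<tau> + \<delta> * real l))\<bar>)"
proof (rule cosh_sample_bound)
  let ?x = "\<lambda>l. \<tau> + \<delta> * real l"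
  have x_nonneg: "0 \<le> ?x l" for l using \<tau> \<delta> by simp
  have diff: "\<delta>\<^sup>2 / 2 * \<bar>(real l)\<^sup>2 - (real i)\<^sup>2\<bar> \<le> \<bar>cosh (?x l) - cosh (?x i)\<bar>" for i l
  proof -
    have "\<delta>\<^sup>2 * \<bar>(real l)\<^sup>2 - (real i)\<^sup>2\<bar> = \<delta> * \<bar>real l - real i\<bar> * (\<delta> * (real l + real i))"
    proof -
      have "(real l)\<^sup>2 - (real i)\<^sup>2 = (real l - real i) * (real l + real i)"
        by (simp add: power2_eq_square algebra_simps)
      then have "\<bar>(real l)\<^sup>2 - (real i)\<^sup>2\<bar> = \<bar>real l - real i\<bar> * (real l + real i)"
        by (simp add: abs_mult)
      then show ?thesis by (simp add: power2_eq_square)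
    qed
    \<comment> \<open>The offset \<open>\<tau>\<close> only widens the gaps, so one bound fits all
      blocks.\<close>
    also have "\<dots> \<le> \<delta> * \<bar>real l - real i\<bar> * (2 * \<tau> + \<delta> * (real l + real i))"
      using \<tau> \<delta> by (intro mult_left_mono) auto
    also have "\<dots> = \<bar>?x l - ?x i\<bar> * \<bar>?x l + ?x i\<bar>"
    proof -
      have "?x l - ?x i = \<delta> * (real l - real i)" by (simp add: algebra_simps)
      then have "\<bar>?x l - ?x i\<bar> = \<delta> * \<bar>real l - real i\<bar>" using \<delta> by (simp add: abs_mult)
      moreover have "\<bar>?x l + ?x i\<bar> = 2 * \<tau> + \<delta> * (real l + real i)"
        using x_nonneg[of l] x_nonneg[of i] by (simp add: algebra_simps)
      ultimately show ?thesis by simp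
    qed
    also have "\<dots> = \<bar>(?x l)\<^sup>2 - (?x i)\<^sup>2\<bar>"
      by (simp only: abs_mult[symmetric] power2_eq_square square_diff_square_factored mult.commute)
    finally show ?thesis using cosh_diff_lower[OF x_nonneg x_nonneg, of l i] by simp
  qed
  show "cosh (?x i) \<noteq> cosh (?x l)" if "i \<noteq> l" for i l
  proof -
    have "(real l)\<^sup>2 \<noteq> (real i)\<^sup>2" using that by (simp add: power2_eq_iff)
    then have "0 < \<delta>\<^sup>2 / 2 * \<bar>(real l)\<^sup>2 - (real i)\<^sup>2\<bar>" using \<delta> by simp
    with diff[of l i] have "0 < \<bar>cosh (?x l) - cosh (?x i)\<bar>" by linarith
    then show ?thesis by (simp only: zero_less_abs_iff right_minus_eq)
  qed
  show "(\<Prod>i\<in>{..n} - {l}. 1 + cosh (?x i))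
      \<le> 2 * exp (real n * X) * (2 / \<delta>) ^ (2 * n) / (fact n)\<^sup>2
        * (\<Prod>i\<in>{..n} - {l}. \<bar>cosh (?x l) - cosh (?x i)\<bar>)" if l: "l \<le> n" for l
  proof -
    have card: "card ({..n} - {l}) = n" using l by simp
    have "(\<Prod>i\<in>{..n} - {l}. 1 + cosh (?x i)) \<le> (\<Prod>i\<in>{..n} - {l}. 2 * exp X)"
    proof (rule prod_mono, rule conjI)
      fix i assume "i \<in> {..n} - {l}"
      then have "\<delta> * real i \<le> \<delta> * real n" using \<delta> by (intro mult_left_mono) auto
      then have "?x i \<le> X" using X by linarith
      then have "exp (?x i) \<le> exp X" by simp
      moreover have "1 \<le> exp (?x i)" using x_nonneg[of i] by simp
      ultimately show "1 + cosh (?x i) \<le> 2 * exp X"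
        using cosh_le_exp[OF x_nonneg[of i]] by linarith
    qed (simp add: cosh_real_nonneg)
    also have "\<dots> = 2 ^ n * exp (real n * X)"
      by (simp only: prod_constant card power_mult_distrib exp_of_nat_mult)
    also have "\<dots> = 2 * exp (real n * X) * (2 / \<delta>) ^ (2 * n) / (fact n)\<^sup>2
        * ((\<delta>\<^sup>2 / 2) ^ n * ((fact n)\<^sup>2 / 2))"
    proof -
      have "(2 / \<delta>)\<^sup>2 * (\<delta>\<^sup>2 / 2) = 2" using \<delta> by (simp add: power_divide)
      then have "(2 / \<delta>) ^ (2 * n) * (\<delta>\<^sup>2 / 2) ^ n = 2 ^ n"
        by (simp only: power_mult power_mult_distrib[symmetric])
      then show ?thesis by simp
    qed
    also have "\<dots> \<le> 2 * exp (real n * X) * (2 / \<delta>) ^ (2 * n) / (fact n)\<^sup>2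
        * ((\<delta>\<^sup>2 / 2) ^ n * (\<Prod>i\<in>{..n} - {l}. \<bar>(real l)\<^sup>2 - (real i)\<^sup>2\<bar>))"
      using \<delta> by (intro mult_left_mono prod_square_diff_lower l) auto
    also have "(\<delta>\<^sup>2 / 2) ^ n * (\<Prod>i\<in>{..n} - {l}. \<bar>(real l)\<^sup>2 - (real i)\<^sup>2\<bar>)
        = (\<Prod>i\<in>{..n} - {l}. \<delta>\<^sup>2 / 2 * \<bar>(real l)\<^sup>2 - (real i)\<^sup>2\<bar>)"
      by (simp only: prod.distrib prod_constant card)
    also have "2 * exp (real n * X) * (2 / \<delta>) ^ (2 * n) / (fact n)\<^sup>2 * \<dots>
        \<le> 2 * exp (real n * X) * (2 / \<delta>) ^ (2 * n) / (fact n)\<^sup>2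
          * (\<Prod>i\<in>{..n} - {l}. \<bar>cosh (?x l) - cosh (?x i)\<bar>)"
      using \<delta> diff by (intro mult_left_mono prod_mono) auto
    finally show ?thesis .
  qed
qed

text \<open>Block \<open>k\<close> consists of the indices congruent to \<open>k\<close> modulo
  \<open>Q\<close> below \<open>K * Q\<close>. Striding, unlike taking consecutive rows, spreads the
  nodes of each block over the whole range and keeps them well separated.\<close>

lemma sum_strided_blocks_le:
  fixes g :: "nat \<Rightarrow> real"
  assumes "\<And>i. 0 \<le> g i" "K * Q \<le> N"
  shows "(\<Sum>k<Q. \<Sum>l<K. g (k + Q * l)) \<le> (\<Sum>i<N. g i)"
proof -
  have block: "(\<Sum>i\<in>{l * Q..<l * Q + Q}. g i) = (\<Sum>k<Q. g (k + Q * l))" for l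
    using sum.shift_bounds_nat_ivl[of g 0 "l * Q" Q]
    by (simp add: atLeast0LessThan add.commute mult.commute)
  have "(\<Sum>k<Q. \<Sum>l<K. g (k + Q * l)) = (\<Sum>l<K. \<Sum>i\<in>{l * Q..<l * Q + Q}. g i)"
    unfolding block by (rule sum.swap)
  also have "\<dots> = (\<Sum>i<K * Q. g i)" by (rule sum.nat_group)
  also have "\<dots> \<le> (\<Sum>i<N. g i)" using assms by (intro sum_mono2) auto
  finally show ?thesis .
qed

section \<open>The matrix of the theorem: norm bounds and a vector with small image\<close>

text \<open>In terms of \<open>a = \<beta> \<mu> / (2 n)\<close>, the matrix of the theorem has the entries \<open>dlr_entry a m i j\<close>
  with \<open>m = n\<^sub>s\<close> and \<open>n = n\<^sub>t\<close>.\<close>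
definition dlr_entry :: "real \<Rightarrow> nat \<Rightarrow> nat \<Rightarrow> nat \<Rightarrow> real" where
  "dlr_entry a m i j = 2 * exp (- (a * real j)) * cosh (real j * (a / real m * real i))"

lemma dlr_entry_bounded:
  assumes "0 < a" "i \<le> m" "1 \<le> m"
  shows "\<bar>dlr_entry a m i j\<bar> \<le> 2"
proof -
  let ?y = "real j * (a / real m * real i)"
  have "a / real m * real i \<le> a" using assms by (simp add: field_simps)
  then have "?y \<le> real j * a" by (rule mult_left_mono) simp
  then have "?y \<le> a * real j" by (simp only: mult.commute)
  moreover have "cosh ?y \<le> exp ?y" using assms by (intro cosh_le_exp) auto
  ultimately have "exp (- (a * real j)) * cosh ?y \<le> exp (- (a * real j)) * exp (a * real j)"
    by (intro mult_left_mono) (auto intro: order.trans)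
  then show ?thesis by (simp add: dlr_entry_def abs_mult exp_minus cosh_real_nonneg)
qed

text \<open>Cauchy-Schwarz in every row, with all entries at most 2 in absolute value.\<close>

lemma dlr_norm_upper:
  assumes "0 < a" "1 \<le> m"
  shows "(\<Sum>i\<le>m. (\<Sum>j\<le>n. dlr_entry a m i j * x j)\<^sup>2)
    \<le> (2 * sqrt (real (m + 1) * real (n + 1)))\<^sup>2 * (\<Sum>j\<le>n. (x j)\<^sup>2)"
proof -
  have "(\<Sum>j\<le>n. dlr_entry a m i j * x j)\<^sup>2 \<le> 4 * (real (n + 1) * (\<Sum>j\<le>n. (x j)\<^sup>2))" if "i \<le> m" for i
  proof -
    have "(\<Sum>j\<le>n. dlr_entry a m i j * x j)\<^sup>2 \<le> real (n + 1) * (\<Sum>j\<le>n. (dlr_entry a m i j * x j)\<^sup>2)"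
      using sum_squared_le[of _ "{..n}"] by simp
    also have "\<dots> \<le> real (n + 1) * (\<Sum>j\<le>n. 2\<^sup>2 * (x j)\<^sup>2)"
    proof (intro mult_left_mono sum_mono)
      fix j
      have "(dlr_entry a m i j)\<^sup>2 \<le> 2\<^sup>2"
        using power_mono[OF dlr_entry_bounded[OF assms(1) that assms(2), of j], of 2] by simp
      then show "(dlr_entry a m i j * x j)\<^sup>2 \<le> 2\<^sup>2 * (x j)\<^sup>2"
        unfolding power_mult_distrib by (rule mult_right_mono) simp
    qed simp
    finally show ?thesis by (simp add: sum_distrib_left[symmetric] mult_ac)
  qed
  then have "(\<Sum>i\<le>m. (\<Sum>j\<le>n. dlr_entry a m i j * x j)\<^sup>2)
      \<le> (\<Sum>i\<le>m. 4 * (real (n + 1) * (\<Sum>j\<le>n. (x j)\<^sup>2)))"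
    by (intro sum_mono) simp
  also have "\<dots> = (2 * sqrt (real (m + 1) * real (n + 1)))\<^sup>2 * (\<Sum>j\<le>n. (x j)\<^sup>2)"
    by (simp add: power_mult_distrib mult_ac del: of_nat_add of_nat_Suc real_sqrt_mult)
  finally show ?thesis .
qed

text \<open>Every block alone bounds the coefficients; adding the \<open>Q\<close> disjoint blocks
  gives the factor \<open>sqrt Q\<close>. One \<open>exp (n * a)\<close> comes from the column
  scaling, the other from the Lagrange numerators.\<close>

lemma dlr_norm_lower:
  assumes a: "0 < a" and n: "1 \<le> n" and m: "1 \<le> m" and Q: "1 \<le> Q" "(n + 1) * Q \<le> m + 1"
  shows "(2 * sqrt (real Q) / (exp (2 * real n * a) * (2 * exp 1 * real m / (real n * a * real Q)) ^ (2 * n)))\<^sup>2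
    * (\<Sum>j\<le>n. (x j)\<^sup>2) \<le> (\<Sum>i\<le>m. (\<Sum>j\<le>n. dlr_entry a m i j * x j)\<^sup>2)"
proof -
  \<comment> \<open>\<open>\<delta>\<close> is the node spacing inside a block, \<open>M\<close> the
    sampling constant for \<open>X = a\<close>, and \<open>L\<close> its simplification after the
    factorial is eliminated.\<close>
  define \<delta> where "\<delta> = a / real m * real Q"
  define M where "M = 2 * exp (real n * a) * (2 / \<delta>) ^ (2 * n) / (fact n)\<^sup>2"
  define L where "L = exp (real n * a) * (2 * exp 1 * real m / (real n * a * real Q)) ^ (2 * n)"
  define v where "v i = (\<Sum>j\<le>n. dlr_entry a m i j * x j)" for i
  define S where "S = (\<Sum>j\<le>n. (x j)\<^sup>2)"
  have \<delta>: "0 < \<delta>" using a m Q by (simp add: \<delta>_def)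
  have M: "0 \<le> M" using \<delta> by (simp add: M_def)
  have L: "0 < L" using a n m Q by (simp add: L_def)
  have M_le_L: "(real n + 1) * M \<le> L"
  proof -
    have "(real n + 1) * M = exp (real n * a) * (2 / (\<delta> * real n)) ^ (2 * n)
        * (2 * (real n + 1) * real n ^ (2 * n) / (fact n)\<^sup>2)"
      using n \<delta> by (simp add: M_def power_divide power_mult_distrib)
    also have "\<dots> \<le> exp (real n * a) * (2 / (\<delta> * real n)) ^ (2 * n) * exp (2 * real n)"
      using fact_square_lower[OF n] \<delta> by (intro mult_left_mono) (auto simp: field_simps)
    also have "exp (2 * real n) = exp 1 ^ (2 * n)"
      using exp_of_nat_mult[of "2 * n" "1::real"] by simp
    also have "exp (real n * a) * (2 / (\<delta> * real n)) ^ (2 * n) * \<dots>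
        = exp (real n * a) * (2 / (\<delta> * real n) * exp 1) ^ (2 * n)"
      by (simp only: power_mult_distrib mult.assoc)
    also have "\<dots> = L"
      using a n m Q by (simp add: L_def \<delta>_def field_simps)
    finally show ?thesis .
  qed
  have block: "4 * S / (exp (real n * a) * L)\<^sup>2 \<le> (\<Sum>l\<le>n. (v (k + Q * l))\<^sup>2)" if k: "k < Q" for k
  proof -
    define c where "c j = 2 * exp (- (a * real j)) * x j" for j
    define \<tau> where "\<tau> = a / real m * real k"
    have node: "a / real m * real (k + Q * l) = \<tau> + \<delta> * real l" for l
      by (simp add: \<tau>_def \<delta>_def distrib_left)
    \<comment> \<open>The last row of a block still exists: \<open>k \<le> Q - 1\<close> and there
      are \<open>m + 1\<close> rows, numbered from 0.\<close>
    have "k + Q * n \<le> m" using k Q(2) by (simp add: algebra_simps)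
    then have "real (k + Q * n) \<le> real m" by (rule of_nat_mono)
    then have X: "\<tau> + \<delta> * real n \<le> a"
      using mult_left_mono[of "real (k + Q * n)" "real m" "a / real m"] a m
      unfolding node by simp
    have v_eq: "v (k + Q * l) = (\<Sum>j\<le>n. c j * cosh (real j * (\<tau> + \<delta> * real l)))" for l
      unfolding v_def c_def dlr_entry_def node by (simp only: mult_ac)
    have "2 * exp (- (real n * a)) * (\<Sum>j\<le>n. \<bar>x j\<bar>) \<le> (\<Sum>j\<le>n. \<bar>c j\<bar>)"
      unfolding sum_distrib_left
    proof (rule sum_mono)
      fix j assume "j \<in> {..n}"
      then have "exp (- (real n * a)) \<le> exp (- (a * real j))" using a by (simp add: mult.commute)
      then show "2 * exp (- (real n * a)) * \<bar>x j\<bar> \<le> \<bar>c j\<bar>"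
        unfolding c_def abs_mult by (intro mult_right_mono) auto
    qed
    also have "\<dots> \<le> M * (\<Sum>l\<le>n. \<bar>v (k + Q * l)\<bar>)"
      unfolding v_eq M_def
      by (rule equispaced_cosh_sample_bound[OF _ \<delta> X]) (use a in \<open>simp add: \<tau>_def\<close>)
    finally have "2 * (\<Sum>j\<le>n. \<bar>x j\<bar>) \<le> exp (real n * a) * (M * (\<Sum>l\<le>n. \<bar>v (k + Q * l)\<bar>))"
      by (simp add: exp_minus field_simps)
    then have "(2 * (\<Sum>j\<le>n. \<bar>x j\<bar>))\<^sup>2 \<le> (exp (real n * a) * (M * (\<Sum>l\<le>n. \<bar>v (k + Q * l)\<bar>)))\<^sup>2"
      by (intro power_mono) (auto intro!: sum_nonneg)
    also have "\<dots> = (exp (real n * a) * M)\<^sup>2 * (\<Sum>l\<le>n. \<bar>v (k + Q * l)\<bar>)\<^sup>2"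
      by (simp add: power_mult_distrib)
    also have "\<dots> \<le> (exp (real n * a) * M)\<^sup>2 * ((real n + 1)\<^sup>2 * (\<Sum>l\<le>n. (v (k + Q * l))\<^sup>2))"
    proof (rule mult_left_mono)
      have "(\<Sum>l\<le>n. \<bar>v (k + Q * l)\<bar>)\<^sup>2 \<le> (real n + 1) * (\<Sum>l\<le>n. (v (k + Q * l))\<^sup>2)"
        using sum_squared_le[of "\<lambda>l. \<bar>v (k + Q * l)\<bar>" "{..n}"] by (simp add: add.commute)
      \<comment> \<open>Squaring the factor is a deliberate loss: it joins \<open>M\<close> as
        \<open>(n + 1) * M\<close>, which \<open>L\<close> bounds.\<close>
      also have "\<dots> \<le> (real n + 1)\<^sup>2 * (\<Sum>l\<le>n. (v (k + Q * l))\<^sup>2)"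
        by (intro mult_right_mono sum_nonneg) (auto simp: power2_eq_square)
      finally show "(\<Sum>l\<le>n. \<bar>v (k + Q * l)\<bar>)\<^sup>2 \<le> (real n + 1)\<^sup>2 * (\<Sum>l\<le>n. (v (k + Q * l))\<^sup>2)" .
    qed simp
    also have "\<dots> = (exp (real n * a) * ((real n + 1) * M))\<^sup>2 * (\<Sum>l\<le>n. (v (k + Q * l))\<^sup>2)"
      by (simp add: power_mult_distrib)
    also have "\<dots> \<le> (exp (real n * a) * L)\<^sup>2 * (\<Sum>l\<le>n. (v (k + Q * l))\<^sup>2)"
      using M_le_L M by (intro mult_right_mono power_mono mult_left_mono sum_nonneg) auto
    finally have "(2 * (\<Sum>j\<le>n. \<bar>x j\<bar>))\<^sup>2 \<le> (exp (real n * a) * L)\<^sup>2 * (\<Sum>l\<le>n. (v (k + Q * l))\<^sup>2)" .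
    moreover have "S \<le> (\<Sum>j\<le>n. \<bar>x j\<bar>)\<^sup>2"
    proof -
      have "S = (\<Sum>j\<le>n. \<bar>x j\<bar> * \<bar>x j\<bar>)" by (simp add: S_def power2_eq_square)
      also have "\<dots> \<le> (\<Sum>j\<le>n. \<bar>x j\<bar> * (\<Sum>j\<le>n. \<bar>x j\<bar>))"
        by (intro sum_mono mult_left_mono member_le_sum) auto
      finally show ?thesis by (simp add: sum_distrib_right[symmetric] power2_eq_square)
    qed
    ultimately have "4 * S \<le> (exp (real n * a) * L)\<^sup>2 * (\<Sum>l\<le>n. (v (k + Q * l))\<^sup>2)"
      by (simp add: power_mult_distrib)
    then show ?thesis using L by (simp add: field_simps)
  qed
  have "(2 * sqrt (real Q) / (exp (real n * a) * L))\<^sup>2 * S = (\<Sum>k<Q. 4 * S / (exp (real n * a) * L)\<^sup>2)"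
    by (simp add: power_divide power_mult_distrib)
  also have "\<dots> \<le> (\<Sum>k<Q. \<Sum>l\<le>n. (v (k + Q * l))\<^sup>2)"
    by (intro sum_mono block) simp
  also have "\<dots> \<le> (\<Sum>i\<le>m. (v i)\<^sup>2)"
    using sum_strided_blocks_le[of "\<lambda>i. (v i)\<^sup>2" "Suc n" Q "Suc m"] Q(2)
    by (simp only: lessThan_Suc_atMost) simp
  also have "exp (real n * a) * L
      = exp (2 * real n * a) * (2 * exp 1 * real m / (real n * a * real Q)) ^ (2 * n)"
    by (simp add: L_def exp_add[symmetric] mult.assoc[symmetric] del: power_mult)
  finally show ?thesis unfolding S_def v_def .
qed

text \<open>Rests on \<open>cosh a - 1 = exp a * (1 - exp (- a))\<^sup>2 / 2\<close> and
  \<open>1 - exp (- a) \<le> a\<close>. The factor \<open>exp a\<close> is kept since the last entry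
  of the test vector below matches it.\<close>

lemma cosh_minus_one_le: "cosh y - 1 \<le> a\<^sup>2 * exp a / 2" if "\<bar>y\<bar> \<le> a" for a y :: real
proof -
  have "cosh y \<le> cosh a"
    using that cosh_real_nonneg_le_iff[of "\<bar>y\<bar>" a] by simp
  also have "cosh a - 1 = exp a * (1 - exp (- a))\<^sup>2 / 2"
  proof -
    have "exp a * (1 - exp (- a))\<^sup>2 = exp a - 2 * (exp a * exp (- a)) + exp a * exp (- a) * exp (- a)"
      by (simp add: power2_eq_square algebra_simps)
    also have "exp a * exp (- a) = 1" by (simp add: exp_minus)
    finally show ?thesis by (simp add: cosh_field_def)
  qed
  also have "(1 - exp (- a))\<^sup>2 \<le> a\<^sup>2"
    using that exp_ge_add_one_self[of "- a"] by (intro power_mono) auto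
  finally show ?thesis by (simp add: mult.commute)
qed

text \<open>The vector is read off from the Chebyshev expansion of \<open>(z - 1) ^ n\<close>, which is tiny at all
  nodes \<open>z\<close> although its leading coefficient is \<open>2 / 2 ^ n\<close>.\<close>
lemma dlr_small_image:
  assumes a: "0 < a" and n: "1 \<le> n" and m: "1 \<le> m"
  obtains w where "(\<Sum>j\<le>n. (w j)\<^sup>2) > 0"
    "(\<Sum>i\<le>m. (\<Sum>j\<le>n. dlr_entry a m i j * w j)\<^sup>2) \<le> (sqrt (real (m + 1)) * a ^ (2 * n))\<^sup>2 * (\<Sum>j\<le>n. (w j)\<^sup>2)"
proof -
  obtain c where c: "\<And>x. (cosh x - 1) ^ n = (\<Sum>j\<le>n. c j * cosh (real j * x))" "c n = 2 / 2 ^ n"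
    using prod_cosh_expansion[of "{..<n}" "\<lambda>_. 1"] n by (auto simp: lessThan_empty_iff)
  \<comment> \<open>The factor \<open>exp (a * j) / 2\<close> undoes the column scaling, so each row
    applied to \<open>w\<close> gives exactly \<open>(z - 1) ^ n\<close> at its node.\<close>
  define w where "w j = c j * exp (a * real j) / 2" for j
  have w_n: "w n = (exp a / 2) ^ n"
    by (simp add: w_def c(2) power_divide exp_of_nat2_mult)
  have le: "(w n)\<^sup>2 \<le> (\<Sum>j\<le>n. (w j)\<^sup>2)" by (intro member_le_sum) auto
  have row: "(\<Sum>j\<le>n. dlr_entry a m i j * w j)\<^sup>2 \<le> (a ^ (2 * n))\<^sup>2 * (w n)\<^sup>2" if "i \<le> m" for i
  proof -
    let ?y = "a / real m * real i"
    have "(\<Sum>j\<le>n. dlr_entry a m i j * w j) = (\<Sum>j\<le>n. c j * cosh (real j * ?y))"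
      by (intro sum.cong refl) (simp add: dlr_entry_def w_def exp_minus)
    also have "\<dots> = (cosh ?y - 1) ^ n" by (simp only: c(1))
    finally have eq: "(\<Sum>j\<le>n. dlr_entry a m i j * w j) = (cosh ?y - 1) ^ n" .
    have "\<bar>?y\<bar> \<le> a" using that a m by (simp add: field_simps)
    then have "(cosh ?y - 1) ^ n \<le> (a\<^sup>2 * exp a / 2) ^ n"
      by (intro power_mono cosh_minus_one_le) (simp_all add: cosh_real_ge_1)
    \<comment> \<open>The exponential and the power of two are exactly \<open>w n\<close>, so they
      cancel in the quotient of the norms.\<close>
    also have "\<dots> = a ^ (2 * n) * w n"
      unfolding w_n power_mult power_mult_distrib[symmetric] by simp
    finally have "((cosh ?y - 1) ^ n)\<^sup>2 \<le> (a ^ (2 * n) * w n)\<^sup>2"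
      by (intro power_mono) (simp_all add: cosh_real_ge_1)
    then show ?thesis unfolding eq by (simp add: power_mult_distrib)
  qed
  have "(\<Sum>i\<le>m. (\<Sum>j\<le>n. dlr_entry a m i j * w j)\<^sup>2) \<le> (\<Sum>i\<le>m. (a ^ (2 * n))\<^sup>2 * (w n)\<^sup>2)"
    by (intro sum_mono row) simp
  also have "\<dots> = (sqrt (real (m + 1)) * a ^ (2 * n))\<^sup>2 * (w n)\<^sup>2"
    by (simp add: power_mult_distrib)
  also have "\<dots> \<le> (sqrt (real (m + 1)) * a ^ (2 * n))\<^sup>2 * (\<Sum>j\<le>n. (w j)\<^sup>2)"
    by (intro mult_left_mono le) simp
  finally have "(\<Sum>i\<le>m. (\<Sum>j\<le>n. dlr_entry a m i j * w j)\<^sup>2) \<le> \<dots>" .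
  moreover have "0 < (w n)\<^sup>2" by (simp add: w_n)
  ultimately show ?thesis using le by (intro that[of w]) linarith+
qed

theorem theorem4p1:
  fixes \<beta> \<mu> h_s h_t q :: real
    and n_s n_t :: nat
    and s t :: "nat \<Rightarrow> real"
    and R :: "real mat"
  assumes "\<beta> > 0" and "\<mu> > 0"
    and "n_s \<ge> 1" and "n_t \<ge> 1" and "n_s \<ge> n_t"
    and "h_s = \<beta> / (2 * real n_s)" and "h_t = \<mu> / real n_t"
    and "\<And>i. i \<le> n_s \<Longrightarrow> s i = h_s * real i"
    and "\<And>j. j \<le> n_t \<Longrightarrow> t j = h_t * real j"
    and "R = mat (n_s + 1) (n_t + 1)
           (\<lambda>(i, j). 2 * exp (- (\<beta> / 2) * t j) * poly (chebyshev_T j) (cosh (s i * h_t)))"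
    and "q = real_of_int \<lfloor>real (n_s + 1) / real (n_t + 1)\<rfloor>"
  shows "2 * (2 * real n_t / (\<beta> * \<mu>)) ^ (2 * n_t) \<le> cond_number R
    \<and> cond_number R \<le> sqrt (real (n_s + 1) * real (n_t + 1) / q) * exp (\<beta> * \<mu>)
        * (4 * exp 1 * real n_s / (\<beta> * \<mu> * q)) ^ (2 * n_t)"
proof -
  define n m a where "n = n_t" and "m = n_s" and "a = \<beta> * \<mu> / (2 * real n_t)"
  have n: "1 \<le> n" and m: "1 \<le> m" and a: "0 < a"
    using assms(1-5) by (simp_all add: n_def m_def a_def)
  define Q where "Q = (m + 1) div (n + 1)"
  have q: "q = real Q"
    using assms(11) floor_divide_of_nat_eq[of "m + 1" "n + 1", where 'a = real]
    by (simp add: Q_def m_def n_def)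
  \<comment> \<open>Positivity of \<open>Q\<close> is where \<open>n_s \<ge> n_t\<close>
    enters.\<close>
  have Q: "1 \<le> Q" "(n + 1) * Q \<le> m + 1"
    unfolding Q_def using assms(5)
    by (simp_all only: times_div_less_eq_dividend) (simp add: m_def n_def Suc_le_eq div_greater_zero_iff)
  have R: "R = mat (Suc m) (Suc n) (\<lambda>(i, j). dlr_entry a m i j)"
  proof -
    have "2 * exp (- (\<beta> / 2) * t j) * poly (chebyshev_T j) (cosh (s i * h_t)) = dlr_entry a m i j"
      if "i \<le> m" "j \<le> n" for i j
    proof -
      have "s i = h_s * real i" "t j = h_t * real j"
        using assms(8)[of i] assms(9)[of j] that by (simp_all add: m_def n_def)
      then have "\<beta> / 2 * t j = a * real j" "s i * h_t = a / real m * real i"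
        by (simp_all add: assms(6,7) a_def m_def mult_ac)
      then show ?thesis by (simp add: dlr_entry_def chebyshev_T_cosh)
    qed
    then show ?thesis
      unfolding assms(10) by (intro cong_mat) (auto simp: m_def n_def)
  qed
  define B where "B = exp (2 * real n * a) * (2 * exp 1 * real m / (real n * a * real Q)) ^ (2 * n)"
  have B: "0 < B" using a n m Q by (simp add: B_def)
  have pos: "0 < 2 * sqrt (real Q) / B" using B Q by simp
  note lower = dlr_norm_lower[OF a n m Q, folded B_def, folded lessThan_Suc_atMost]
  have "cond_number R \<le> 2 * sqrt (real (m + 1) * real (n + 1)) / (2 * sqrt (real Q) / B)"
    unfolding R
    by (rule cond_number_le[OF _ _ pos _ lower])
      (use dlr_norm_upper[OF a m] in \<open>simp_all add: lessThan_Suc_atMost\<close>)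
  also have "\<dots> = sqrt (real (m + 1) * real (n + 1) / q) * B"
    by (simp add: q real_sqrt_divide)
  \<comment> \<open>Here \<open>2 * n * a = \<beta> * \<mu>\<close>, which also turns the constant 2
    in the base into 4.\<close>
  also have "B = exp (\<beta> * \<mu>) * (4 * exp 1 * real n_s / (\<beta> * \<mu> * q)) ^ (2 * n_t)"
    using n by (simp add: B_def a_def n_def m_def q field_simps)
  finally have upper: "cond_number R \<le> sqrt (real (m + 1) * real (n + 1) / q) * exp (\<beta> * \<mu>)
        * (4 * exp 1 * real n_s / (\<beta> * \<mu> * q)) ^ (2 * n_t)"
    by (simp only: mult.assoc)
  obtain w where w: "(\<Sum>j\<le>n. (w j)\<^sup>2) > 0"
    "(\<Sum>i\<le>m. (\<Sum>j\<le>n. dlr_entry a m i j * w j)\<^sup>2) \<le> (sqrt (real (m + 1)) * a ^ (2 * n))\<^sup>2 * (\<Sum>j\<le>n. (w j)\<^sup>2)"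
    using dlr_small_image[OF a n m] by blast
  \<comment> \<open>The first unit vector: its image is the first column, constantly 2, of norm
    \<open>2 * sqrt (m + 1)\<close>.\<close>
  define u :: "nat \<Rightarrow> real" where "u j = (if j = 0 then 1 else 0)" for j
  have u_entry: "(u j)\<^sup>2 = (if j = 0 then 1 else 0)"
    "dlr_entry a m i j * u j = (if j = 0 then 2 else 0)" for i j
    by (simp_all add: u_def dlr_entry_def)
  have u: "(\<Sum>j\<le>n. (u j)\<^sup>2) = 1" "(\<Sum>j\<le>n. dlr_entry a m i j * u j) = 2" for i
    unfolding u_entry by simp_all
  \<comment> \<open>\<open>lower\<close> is reused to ensure full column rank; the common factor
    \<open>sqrt (m + 1)\<close> of the two test vectors then cancels.\<close>
  have "2 * sqrt (real (m + 1)) / (sqrt (real (m + 1)) * a ^ (2 * n)) \<le> cond_number R"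
    unfolding R
    by (rule cond_number_ge[OF _ _ pos _ lower _ _ w[folded lessThan_Suc_atMost], where u = u])
      (use a in \<open>simp_all only: lessThan_Suc_atMost u, simp_all add: power_mult_distrib\<close>)
  also have "2 * sqrt (real (m + 1)) / (sqrt (real (m + 1)) * a ^ (2 * n)) = 2 * (1 / a) ^ (2 * n)"
    by (simp add: power_divide)
  also have "1 / a = 2 * real n_t / (\<beta> * \<mu>)" by (simp add: a_def)
  finally show ?thesis using upper by (simp add: n_def m_def)
qed

end
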